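(* The connected sum of framed chord diagrams is not a well-defined operation in $\mathcal{M}^f$: there exist framed chord diagrams $D_1$ and $D_2$ and two connected sums $D$ and $D'$ of $D_1$ and $D_2$ (obtained by different choices of the points at which the core circles are cut) such that $D\neq D'$ in $\mathcal{M}^f$.
   Context: A chord diagram is a finite cubic graph consisting of a distinguished oriented Hamiltonian cycle (the core circle) and finitely many non-oriented edges (chords) joining points of the core circle, so that every point of the core circle is incident to at most one chord; the oriented circle with no chords is also allowed. It is framed if every chord is assigned a framing in $\mathbb{Z}/2\mathbb{Z}=\{0,1\}$. Framed chord diagrams are considered up to isomorphisms preserving the core circle, its orientation and the framing. $M^f$ is the free $\mathbb{Z}$-module generated by (isomorphism classes of) framed chord diagrams. $4$T-relations. Fix a framed chord diagram together with a chord $b$ of it with endpoints $p,q$ and a further marked point $y$ on the core circle, distinct from all chord endpoints. For $r\in\{p,q\}$, let $r^-$ (resp. $r^+$) denote a point lying immediately before (resp. immediately after) $r$ with respect to the orientation of the core circle, so that no chord endpoint and not the point $y$ lies strictly between it and $r$. For $x\in\{p^-,p^+,q^-,q^+\}$ and $\varepsilon\in\{0,1\}$, let $D_\varepsilon(x)$ be the framed chord diagram obtained by adding a chord $a$ of framing $\varepsilon$ joining $y$ to $x$, everything else being unchanged. If $b$ has framing $0$, the $4$T-relation is $D_\varepsilon(p^-)-D_\varepsilon(p^+)=D_\varepsilon(q^+)-D_\varepsilon(q^-)$. If $b$ has framing $1$, the $4$T-relation is $D_\varepsilon(p^-)-D_\varepsilon(p^+)=D_{1-\varepsilon}(q^-)-D_{1-\varepsilon}(q^+)$.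 $\mathcal{M}^f$ is the quotient of $M^f$ by the submodule generated by all these relations. A connected sum of framed chord diagrams $D_1$ and $D_2$ is a framed chord diagram obtained by choosing a point on each of the two core circles that is not a chord endpoint, cutting the two core circles at the chosen points, and gluing the two resulting oriented arcs into one oriented circle respecting the orientations, keeping all chords and their framings. *)

theory Defs
  imports
    "HOL-Library.Z2"
    "HOL-Algebra.Free_Abelian_Groups"
    "HOL-Algebra.Coset"
begin

section \<open>Framed chord diagrams\<close>

text \<open>
  Cutting the core circle of a framed chord diagram at a point that is not a chord endpoint leaves
  an oriented arc, and the diagram on it is the word that lists, in the order of the orientation,
  the chord met at each endpoint.  Every chord occurs exactly twice in this word.  A chord is
  represented by an arbitrary name together with its framing in \<open>\<int>/2\<int>\<close> (type \<^typ>\<open>bit\<close>), so the two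
  occurrences of a chord carry the same framing.  The empty word is the circle without chords.
\<close>

type_synonym chord = "nat \<times> bit"

definition chord_word :: "chord list \<Rightarrow> bool" where
  "chord_word w \<longleftrightarrow> (\<forall>c\<in>set w. count_list w c = 2)"

text \<open>
  Two words give isomorphic diagrams iff they agree up to the choice of the cutting point
  (a rotation) and up to a bijection of the chords that preserves framings.
\<close>

definition chord_word_iso :: "chord list \<Rightarrow> chord list \<Rightarrow> bool" where
  "chord_word_iso v w \<longleftrightarrow> chord_word v \<and>
     (\<exists>k \<pi>. inj_on \<pi> (set v) \<and> (\<forall>c\<in>set v. snd (\<pi> c) = snd c) \<and> w = map \<pi> (rotate k v))"

lemma count_list_rotate1: "count_list (rotate1 w) c = count_list w c"
  by (cases w) auto

lemma count_list_rotate [simp]: "count_list (rotate k w) c = count_list w c"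
  by (induction k) (auto simp: count_list_rotate1)

lemma count_list_map_inj_on:
  "inj_on f (insert c (set w)) \<Longrightarrow> count_list (map f w) (f c) = count_list w c"
  by (induction w) (auto simp: inj_on_def)

lemma chord_word_iso_imp_chord_word:
  assumes "chord_word_iso v w" shows "chord_word w"
proof -
  from assms obtain k \<pi> where v: "chord_word v" and inj: "inj_on \<pi> (set v)"
    and w: "w = map \<pi> (rotate k v)"
    unfolding chord_word_iso_def by blast
  have "count_list w (\<pi> c) = 2" if "c \<in> set v" for c
    using count_list_map_inj_on[of \<pi> c "rotate k v"] that inj v w
    by (simp add: insert_absorb chord_word_def)
  then show ?thesis
    using w by (auto simp: chord_word_def)
qed

lemma chord_word_iso_refl: "chord_word w \<Longrightarrow> chord_word_iso w w"
  unfolding chord_word_iso_def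
  by (intro conjI exI[of _ "0::nat"] exI[of _ "\<lambda>c. c"]) (auto simp: inj_on_def)

lemma chord_word_iso_sym:
  assumes "chord_word_iso v w" shows "chord_word_iso w v"
proof -
  from assms obtain k \<pi> where inj: "inj_on \<pi> (set v)"
    and fr: "\<forall>c\<in>set v. snd (\<pi> c) = snd c" and w: "w = map \<pi> (rotate k v)"
    unfolding chord_word_iso_def by blast
  let ?\<rho> = "the_inv_into (set v) \<pi>"
  let ?l = "length v - k mod length v"
  have sw: "set w = \<pi> ` set v" using w by simp
  have inv: "?\<rho> (\<pi> c) = c" if "c \<in> set v" for c
    using the_inv_into_f_f[OF inj that] .
  have 1: "inj_on ?\<rho> (set w)"
    unfolding sw by (rule inj_on_the_inv_into[OF inj])
  have 2: "\<forall>c\<in>set w. snd (?\<rho> c) = snd c"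
    using sw inv fr by auto
  have "map ?\<rho> w = rotate k v"
    unfolding w by (auto simp: inv intro!: map_idI)
  also have "\<dots> = rotate (k mod length v) v"
    by (rule rotate_conv_mod)
  finally have "map ?\<rho> (rotate ?l w) = rotate (?l + k mod length v) v"
    by (simp add: rotate_map[symmetric] rotate_rotate)
  also have "\<dots> = v"
  proof (cases "v = []")
    case False
    then have "k mod length v < length v" by simp
    then have "?l + k mod length v = length v" by linarith
    then show ?thesis by (simp add: rotate_id)
  qed simp
  finally have 3: "v = map ?\<rho> (rotate ?l w)" by simp
  from chord_word_iso_imp_chord_word[OF assms] 1 2 3 show ?thesis
    unfolding chord_word_iso_def by blast
qed

lemma chord_word_iso_trans:
  assumes "chord_word_iso u v" "chord_word_iso v w" shows "chord_word_iso u w"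
proof -
  from assms obtain k \<pi> l \<rho> where u: "chord_word u"
    and \<pi>: "inj_on \<pi> (set u)" "\<forall>c\<in>set u. snd (\<pi> c) = snd c" "v = map \<pi> (rotate k u)"
    and \<rho>: "inj_on \<rho> (set v)" "\<forall>c\<in>set v. snd (\<rho> c) = snd c" "w = map \<rho> (rotate l v)"
    unfolding chord_word_iso_def by blast
  have "inj_on (\<rho> \<circ> \<pi>) (set u)"
    using \<pi> \<rho> by (intro comp_inj_on) auto
  moreover have "\<forall>c\<in>set u. snd ((\<rho> \<circ> \<pi>) c) = snd c"
    using \<pi> \<rho> by auto
  moreover have "w = map (\<rho> \<circ> \<pi>) (rotate (l + k) u)"
    using \<pi>(3) \<rho>(3) by (simp add: rotate_map rotate_rotate)
  ultimately show ?thesis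
    using u unfolding chord_word_iso_def by blast
qed

quotient_type framed_chord_diagram = "chord list" / partial: chord_word_iso
proof (rule part_equivpI)
  show "\<exists>w. chord_word_iso w w"
    by (rule exI[of _ "[]"]) (simp add: chord_word_iso_refl chord_word_def)
  show "symp chord_word_iso"
    by (auto intro: sympI chord_word_iso_sym)
  show "transp chord_word_iso"
    by (auto intro: transpI chord_word_iso_trans)
qed

text \<open>
  \<open>close w\<close> glues the ends of the arc together.  It is only meaningful if \<^term>\<open>chord_word w\<close> holds.
  \<open>cut_of w D\<close>: cutting \<open>D\<close> at some point of the core circle gives the word \<open>w\<close>.
\<close>

abbreviation close :: "chord list \<Rightarrow> framed_chord_diagram" where
  "close \<equiv> abs_framed_chord_diagram"

definition cut_of :: "chord list \<Rightarrow> framed_chord_diagram \<Rightarrow> bool" where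
  "cut_of w D \<longleftrightarrow> chord_word w \<and> close w = D"

lemma close_eq_iff:
  "chord_word v \<Longrightarrow> chord_word w \<Longrightarrow> close v = close w \<longleftrightarrow> chord_word_iso v w"
  using Quotient_rel[OF Quotient_framed_chord_diagram] by (metis chord_word_iso_refl)

lemma cut_of_exists: "\<exists>w. cut_of w D"
  by (metis Quotient_abs_rep[OF Quotient_framed_chord_diagram]
      Quotient_rep_reflp[OF Quotient_framed_chord_diagram] cut_of_def chord_word_iso_def)


section \<open>The module of framed chord diagrams modulo the 4T-relations\<close>

text \<open>
  \<open>\<int>\<close>-modules are abelian groups and their submodules are subgroups, so the free module, the
  submodule generated by the relations and the quotient are taken in \<open>HOL-Algebra\<close>.
\<close>

abbreviation diagram_module :: "(framed_chord_diagram \<Rightarrow>\<^sub>0 int) monoid" where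
  "diagram_module \<equiv> free_Abelian_group UNIV"

text \<open>
  The diagram is cut at the marked point \<open>y\<close>, which gives a word \<open>A b B b C\<close> with the two endpoints
  \<open>p\<close>, \<open>q\<close> of \<open>b\<close> displayed.  The new chord \<open>a\<close>, with a name \<open>n\<close> that is not in use, has one endpoint
  at \<open>y\<close>, that is, at the beginning of the word, and the other one next to \<open>p\<close> or \<open>q\<close>.  Exchanging
  the roles of \<open>p\<close> and \<open>q\<close> leads to the same relations up to sign and the exchange of \<open>\<epsilon>\<close>, \<open>1 - \<epsilon>\<close>.
  An element of \<open>four_term\<close> is the left-hand side minus the right-hand side of a relation.
\<close>

inductive_set four_term :: "(framed_chord_diagram \<Rightarrow>\<^sub>0 int) set" where
  framing_0:
  "chord_word (A @ [b] @ B @ [b] @ C) \<Longrightarrow> snd b = 0 \<Longrightarrow>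
   n \<notin> fst ` set (A @ [b] @ B @ [b] @ C) \<Longrightarrow> a = (n, \<epsilon>) \<Longrightarrow>
     (frag_of (close ([a] @ A @ [a, b] @ B @ [b] @ C))
      - frag_of (close ([a] @ A @ [b, a] @ B @ [b] @ C)))
     - (frag_of (close ([a] @ A @ [b] @ B @ [b, a] @ C))
        - frag_of (close ([a] @ A @ [b] @ B @ [a, b] @ C))) \<in> four_term"
| framing_1:
  "chord_word (A @ [b] @ B @ [b] @ C) \<Longrightarrow> snd b = 1 \<Longrightarrow>
   n \<notin> fst ` set (A @ [b] @ B @ [b] @ C) \<Longrightarrow> a = (n, \<epsilon>) \<Longrightarrow> a' = (n, 1 - \<epsilon>) \<Longrightarrow>
     (frag_of (close ([a] @ A @ [a, b] @ B @ [b] @ C))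
      - frag_of (close ([a] @ A @ [b, a] @ B @ [b] @ C)))
     - (frag_of (close ([a'] @ A @ [b] @ B @ [a', b] @ C))
        - frag_of (close ([a'] @ A @ [b] @ B @ [b, a'] @ C))) \<in> four_term"

abbreviation four_term_submodule :: "(framed_chord_diagram \<Rightarrow>\<^sub>0 int) set" where
  "four_term_submodule \<equiv> generate diagram_module four_term"

definition diagram_module_4T :: "(framed_chord_diagram \<Rightarrow>\<^sub>0 int) set monoid" where
  "diagram_module_4T = diagram_module Mod four_term_submodule"

definition diagram_class :: "framed_chord_diagram \<Rightarrow> (framed_chord_diagram \<Rightarrow>\<^sub>0 int) set" where
  "diagram_class D = four_term_submodule #>\<^bsub>diagram_module\<^esub> frag_of D"

lemma comm_group_diagram_module_4T: "comm_group diagram_module_4T"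
  unfolding diagram_module_4T_def
  by (intro comm_group.abelian_FactGroup group.generate_is_subgroup)
    (auto simp: abelian_free_Abelian_group)

lemma diagram_class_in_carrier: "diagram_class D \<in> carrier diagram_module_4T"
  unfolding diagram_module_4T_def diagram_class_def
  by (auto simp: FactGroup_def RCOSETS_def)


section \<open>Connected sums\<close>

text \<open>
  The condition on the sets of chords makes the union of the chords of the two diagrams disjoint;
  it does not restrict the diagrams, since names can be changed within an isomorphism class.
\<close>

definition connected_sum ::
  "framed_chord_diagram \<Rightarrow> framed_chord_diagram \<Rightarrow> framed_chord_diagram \<Rightarrow> bool" where
  "connected_sum D\<^sub>1 D\<^sub>2 D \<longleftrightarrow>
     (\<exists>w\<^sub>1 w\<^sub>2. cut_of w\<^sub>1 D\<^sub>1 \<and> cut_of w\<^sub>2 D\<^sub>2 \<and> set w\<^sub>1 \<inter> set w\<^sub>2 = {} \<and> D = close (w\<^sub>1 @ w\<^sub>2))"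

end

theory Submission
  imports Defs
begin

text \<open>
  Among the diagrams with three chords, consider the row, three isolated chords of framing 1, and
  the split, a chord of framing 0 with one isolated chord of framing 1 on either side.  Let the
  excess of a linear combination of diagrams be the coefficient of the row minus the coefficient of
  the split.  The excess vanishes on all 4T-relations, so it is well defined on the quotient
  (\<open>four_term_excess\<close>, \<open>submodule_excess\<close>).

  To see why, let \<open>a\<close> be the chord that slides along \<open>b\<close> in a relation in which one of the two diagrams
  occurs.  If \<open>b\<close> has framing 1, the row occurs only with \<open>a\<close> and \<open>b\<close> as neighbouring isolated chords.
  Sliding the end of \<open>a\<close> that is next to \<open>b\<close> across both ends of \<open>b\<close> makes \<open>a\<close> a chord of framing 0 that
  cuts off \<open>b\<close>, which is the split, and both diagrams have the same sign in the relation; the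
  split occurs only in this way.  If \<open>b\<close> has framing 0, the row does not occur, and the split occurs
  only with \<open>b\<close> as the chord of framing 0 and \<open>a\<close> as an isolated chord.  Moving an end of \<open>a\<close> from one
  end of \<open>b\<close> to the other on the same side of \<open>b\<close> gives the split again, with the opposite sign.

  Now take the sum of one isolated chord of framing 1 with a pair of isolated chords of framings 0
  and 1.  If the pair is cut between the two neighbouring ends of its chord of framing 0, this chord
  separates the other two in the sum, which is the split and has excess \<open>-1\<close>.  If the pair is cut
  between its two chords, the sum has three isolated chords, one of them of framing 0, and its
  excess is \<open>0\<close>.
\<close>

section \<open>Recognising diagrams from words\<close>

lemma close_rotate:
  assumes "chord_word w"
  shows "close (rotate k w) = close w"
proof -
  have "chord_word_iso w (rotate k w)"
    using assms unfolding chord_word_iso_def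
    by (auto intro!: exI[of _ k] exI[of _ "\<lambda>c. c"])
  then show ?thesis
    using close_eq_iff assms chord_word_iso_imp_chord_word by metis
qed

definition row_word :: "chord list" where
  "row_word = [(0, 1), (0, 1), (1, 1), (1, 1), (2, 1), (2, 1)]"

definition split_word :: "chord list" where
  "split_word = [(0, 0), (1, 1), (1, 1), (0, 0), (2, 1), (2, 1)]"

lemma chord_word_row: "chord_word row_word"
  by (simp add: row_word_def chord_word_def)

lemma chord_word_split: "chord_word split_word"
  by (simp add: split_word_def chord_word_def)

lemma close_eqE:
  assumes "chord_word w" "chord_word v" "close w = close v" "v \<noteq> []"
  obtains k \<pi> where "k < length v" "\<forall>c\<in>set v. snd (\<pi> c) = snd c" "w = map \<pi> (rotate k v)"
proof -
  have "chord_word_iso v w" using assms close_eq_iff by metis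
  then obtain k \<pi> where "\<forall>c\<in>set v. snd (\<pi> c) = snd c" "w = map \<pi> (rotate k v)"
    unfolding chord_word_iso_def by blast
  then show ?thesis
    using assms(4) that[of "k mod length v" \<pi>] by (simp flip: rotate_conv_mod)
qed

lemma close_mapI:
  assumes "chord_word v" "inj_on \<pi> (set v)" "\<forall>c\<in>set v. snd (\<pi> c) = snd c"
  shows "close (map \<pi> v) = close v"
proof -
  have "chord_word_iso v (map \<pi> v)"
    using assms unfolding chord_word_iso_def by (auto intro!: exI[of _ 0] exI[of _ \<pi>])
  then show ?thesis
    using close_eq_iff assms(1) chord_word_iso_imp_chord_word by metis
qed

lemma close_row:
  assumes "distinct [p, r, t]" "snd p = 1" "snd r = 1" "snd t = 1"
  shows "close [p, p, r, r, t, t] = close row_word"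
  using close_mapI[OF chord_word_row, of "\<lambda>c. if fst c = 0 then p else if fst c = 1 then r else t"]
    assms by (auto simp: row_word_def inj_on_def)

lemma close_split:
  assumes "distinct [p, r, t]" "snd p = 0" "snd r = 1" "snd t = 1"
  shows "close [p, r, r, p, t, t] = close split_word"
  using close_mapI[OF chord_word_split, of "\<lambda>c. if fst c = 0 then p else if fst c = 1 then r else t"]
    assms by (auto simp: split_word_def inj_on_def)

lemma rotate_6:
  fixes p q r s t u :: chord
  assumes "k < 6"
  shows "rotate k [p, q, r, s, t, u] \<in> {[p, q, r, s, t, u], [q, r, s, t, u, p],
    [r, s, t, u, p, q], [s, t, u, p, q, r], [t, u, p, q, r, s], [u, p, q, r, s, t]}"
proof -
  have "k = 0 \<or> k = Suc 0 \<or> k = Suc (Suc 0) \<or> k = Suc (Suc (Suc 0)) \<or>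
      k = Suc (Suc (Suc (Suc 0))) \<or> k = Suc (Suc (Suc (Suc (Suc 0))))"
    using assms by linarith
  then show ?thesis by (elim disjE) simp_all
qed

text \<open>
  The row is invariant under rotation by two places, the split under rotation by three.  Hence the
  two and the three alternatives below exhaust the six rotations of each reference word.
\<close>

lemma close_eq_row_iff:
  assumes "chord_word [p, q, r, s, t, u]"
  shows "close [p, q, r, s, t, u] = close row_word \<longleftrightarrow>
    (\<forall>c\<in>{p, q, r, s, t, u}. snd c = 1) \<and> (p = q \<and> r = s \<and> t = u \<or> q = r \<and> s = t \<and> u = p)"
    (is "?L \<longleftrightarrow> ?R")
proof
  assume ?L
  moreover have "row_word \<noteq> []" by (simp add: row_word_def)
  ultimately obtain k \<pi> where "k < length row_word"
    and \<pi>: "\<forall>c\<in>set row_word. snd (\<pi> c) = snd c"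
    and eq: "[p, q, r, s, t, u] = map \<pi> (rotate k row_word)"
    using close_eqE[OF assms chord_word_row] by metis
  then have k: "k < 6" by (simp add: row_word_def)
  have fr: "snd (\<pi> (0, 1)) = snd (0, 1)" "snd (\<pi> (1, 1)) = 1" "snd (\<pi> (2, 1)) = 1"
    using \<pi> by (auto simp: row_word_def)
  from rotate_6[OF k, of "(0, 1)" "(0, 1)" "(1, 1)" "(1, 1)" "(2, 1)" "(2, 1)"] eq fr show ?R
    unfolding row_word_def by (elim insertE emptyE) simp_all
next
  assume R: ?R
  then have "distinct [p, r, t] \<or> distinct [q, s, u]"
    using assms by (auto simp: chord_word_def split: if_splits)
  with R assms show ?L
    using close_row[of p r t] close_row[of u q s] close_rotate[of "[u, u, q, q, s, s]" 1]
    by (auto simp: chord_word_def split: if_splits)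
qed

lemma close_eq_split_iff:
  assumes "chord_word [p, q, r, s, t, u]"
  shows "close [p, q, r, s, t, u] = close split_word \<longleftrightarrow>
    p = s \<and> q = r \<and> t = u \<and> snd p = 0 \<and> snd q = 1 \<and> snd t = 1 \<or>
    q = t \<and> r = s \<and> u = p \<and> snd q = 0 \<and> snd r = 1 \<and> snd u = 1 \<or>
    r = u \<and> s = t \<and> p = q \<and> snd r = 0 \<and> snd s = 1 \<and> snd p = 1"
    (is "?L \<longleftrightarrow> ?R")
proof
  assume ?L
  moreover have "split_word \<noteq> []" by (simp add: split_word_def)
  ultimately obtain k \<pi> where "k < length split_word"
    and \<pi>: "\<forall>c\<in>set split_word. snd (\<pi> c) = snd c"
    and eq: "[p, q, r, s, t, u] = map \<pi> (rotate k split_word)"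
    using close_eqE[OF assms chord_word_split] by metis
  then have k: "k < 6" by (simp add: split_word_def)
  have fr: "snd (\<pi> (0, 0)) = snd (0, 0)" "snd (\<pi> (1, 1)) = 1" "snd (\<pi> (2, 1)) = 1"
    using \<pi> by (auto simp: split_word_def)
  from rotate_6[OF k, of "(0, 0)" "(1, 1)" "(1, 1)" "(0, 0)" "(2, 1)" "(2, 1)"] eq fr show ?R
    unfolding split_word_def by (elim insertE emptyE) simp_all
next
  assume ?R
  then consider
    "p = s" "q = r" "t = u" "snd p = 0" "snd q = 1" "snd t = 1"
    | "q = t" "r = s" "u = p" "snd q = 0" "snd r = 1" "snd u = 1"
    | "r = u" "s = t" "p = q" "snd r = 0" "snd s = 1" "snd p = 1" by blast
  then show ?L
  proof cases
    case 1
    then show ?thesis using close_split[of p q t] assms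
      by (auto simp: chord_word_def split: if_splits)
  next
    case 2
    then show ?thesis using close_split[of q r u] assms close_rotate[OF assms, of 1]
      by (auto simp: chord_word_def split: if_splits)
  next
    case 3
    then show ?thesis using close_split[of r s p] assms close_rotate[OF assms, of 2]
      by (auto simp: chord_word_def numeral_eq_Suc split: if_splits)
  qed
qed

section \<open>The excess and the 4T-relations\<close>

lemma one_further_chord_cases:
  assumes "chord_word (A @ [b] @ B @ [b] @ C)" "length (A @ B @ C) = 2"
  obtains c where "c \<noteq> b" "(A, B, C) \<in> {([c, c], [], []), ([], [c, c], []), ([], [], [c, c]),
    ([c], [c], []), ([c], [], [c]), ([], [c], [c])}"
proof -
  obtain c d where cd: "A @ B @ C = [c, d]"
    using assms(2) by (metis (no_types) length_0_conv length_Suc_conv numeral_2_eq_2)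
  have count: "count_list (A @ [b] @ B @ [b] @ C) x = count_list [c, d] x + (if x = b then 2 else 0)" for x
    unfolding cd[symmetric] by simp
  have "set (A @ [b] @ B @ [b] @ C) = {b, c, d}"
    using arg_cong[OF cd, of set] by auto
  then have "count_list (A @ [b] @ B @ [b] @ C) x = 2" if "x \<in> {b, c, d}" for x
    using assms(1) that unfolding chord_word_def by blast
  from this[of b] this[of c] this[of d] have "c \<noteq> b" "d = c"
    unfolding count by (auto split: if_splits)
  with cd that[of c] show ?thesis
    by (auto simp: append_eq_Cons_conv)
qed

lemma chord_word_insert:
  assumes "chord_word w" "c \<notin> set w" 
    "\<And>x. count_list v x = count_list w x + (if x = c then 2 else 0)"
  shows "chord_word v"
proof -
  have "set v = insert c (set w)"
  proof (rule Set.set_eqI)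
    show "x \<in> set v \<longleftrightarrow> x \<in> insert c (set w)" for x
      using assms(3)[of x] count_list_0_iff[of v x] count_list_0_iff[of w x]
      by (auto split: if_splits)
  qed
  then show ?thesis
    using assms by (auto simp: chord_word_def count_list_0_iff)
qed

lemma close_length:
  assumes "chord_word w" "chord_word v" "close w = close v"
  shows "length w = length v"
  using assms by (auto simp: close_eq_iff chord_word_iso_def)

definition excess :: "(framed_chord_diagram \<Rightarrow>\<^sub>0 int) \<Rightarrow> int" where
  "excess x = Poly_Mapping.lookup x (close row_word) - Poly_Mapping.lookup x (close split_word)"

lemma excess_linear:
  "excess 0 = 0" "excess (x + y) = excess x + excess y" "excess (x - y) = excess x - excess y"
  "excess (- x) = - excess x"
  by (simp_all add: excess_def lookup_add lookup_minus)

lemma excess_frag_of: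
  "excess (frag_of D) = of_bool (D = close row_word) - of_bool (D = close split_word)"
  by (auto simp: excess_def lookup_single when_def)

lemma excess_six:
  assumes "chord_word [p, q, r, s, t, u]"
  shows "excess (frag_of (close [p, q, r, s, t, u])) =
    of_bool ((\<forall>c\<in>{p, q, r, s, t, u}. snd c = 1) \<and>
      (p = q \<and> r = s \<and> t = u \<or> q = r \<and> s = t \<and> u = p)) -
    of_bool (p = s \<and> q = r \<and> t = u \<and> snd p = 0 \<and> snd q = 1 \<and> snd t = 1 \<or>
      q = t \<and> r = s \<and> u = p \<and> snd q = 0 \<and> snd r = 1 \<and> snd u = 1 \<or>
      r = u \<and> s = t \<and> p = q \<and> snd r = 0 \<and> snd s = 1 \<and> snd p = 1)"
  unfolding excess_frag_of close_eq_row_iff[OF assms] close_eq_split_iff[OF assms] ..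

lemma excess_not_six:
  assumes "chord_word v" "length v \<noteq> 6"
  shows "excess (frag_of (close v)) = 0"
  using assms close_length[OF assms(1) chord_word_row] close_length[OF assms(1) chord_word_split]
  by (auto simp: excess_frag_of row_word_def split_word_def)

text \<open>
  Only relations between diagrams with three chords matter, and these arise by adding \<open>a\<close> to a
  diagram with just one chord \<open>c\<close> besides \<open>b\<close>.  Six positions of \<open>c\<close> relative to \<open>b\<close> and to the marked
  point remain.
\<close>

lemma four_term_excess:
  assumes "x \<in> four_term"
  shows "excess x = 0"
  using assms
proof cases
  case (framing_0 A b B C n a \<epsilon>)
  let ?w = "A @ [b] @ B @ [b] @ C"
  have a: "a \<notin> set ?w" using framing_0 by force
  have cw: "chord_word ([a] @ A @ [a, b] @ B @ [b] @ C)" "chord_word ([a] @ A @ [b, a] @ B @ [b] @ C)"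
    "chord_word ([a] @ A @ [b] @ B @ [b, a] @ C)" "chord_word ([a] @ A @ [b] @ B @ [a, b] @ C)"
    by (rule chord_word_insert[OF framing_0(2) a]; simp)+
  show ?thesis
  proof (cases "length (A @ B @ C) = 2")
    case False
    then show ?thesis
      unfolding framing_0(1) using cw by (simp add: excess_linear excess_not_six)
  next
    case True
    obtain c where "c \<noteq> b" "(A, B, C) \<in> {([c, c], [], []), ([], [c, c], []), ([], [], [c, c]),
      ([c], [c], []), ([c], [], [c]), ([], [c], [c])}"
      using one_further_chord_cases[OF framing_0(2) True] by metis
    then show ?thesis
      unfolding framing_0(1) using cw a framing_0(3)
      by (elim insertE emptyE Pair_inject)
        (auto simp: excess_linear excess_six)
  qed
next
  case (framing_1 A b B C n a \<epsilon> a')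
  let ?w = "A @ [b] @ B @ [b] @ C"
  have a: "a \<notin> set ?w" "a' \<notin> set ?w" using framing_1 by force+
  have cw: "chord_word ([a] @ A @ [a, b] @ B @ [b] @ C)" "chord_word ([a] @ A @ [b, a] @ B @ [b] @ C)"
    by (rule chord_word_insert[OF framing_1(2) a(1)]; simp)+
  have cw': "chord_word ([a'] @ A @ [b] @ B @ [b, a'] @ C)"
      "chord_word ([a'] @ A @ [b] @ B @ [a', b] @ C)"
    by (rule chord_word_insert[OF framing_1(2) a(2)]; simp)+
  \<comment> \<open>the change of framing is what turns the row into the split\<close>
  have fr: "snd a = 1 \<longleftrightarrow> snd a' = 0"
    using framing_1 by (cases \<epsilon>) auto
  show ?thesis
  proof (cases "length (A @ B @ C) = 2")
    case False
    then show ?thesis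
      unfolding framing_1(1) using cw cw' by (simp add: excess_linear excess_not_six)
  next
    case True
    obtain c where "c \<noteq> b" "(A, B, C) \<in> {([c, c], [], []), ([], [c, c], []), ([], [], [c, c]),
      ([c], [c], []), ([c], [], [c]), ([], [c], [c])}"
      using one_further_chord_cases[OF framing_1(2) True] by metis
    then show ?thesis
      unfolding framing_1(1) using cw cw' a framing_1(3) fr
      by (elim insertE emptyE Pair_inject)
        (auto simp: excess_linear excess_six)
  qed
qed

lemma submodule_excess:
  assumes "x \<in> four_term_submodule"
  shows "excess x = 0"
  using assms
  by (induction rule: generate.induct)
    (auto simp: four_term_excess excess_linear inv_free_Abelian_group)

lemma diagram_class_eqD:
  assumes "diagram_class D = diagram_class D'"
  shows "frag_of D - frag_of D' \<in> four_term_submodule"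
proof -
  have "frag_of D \<in> diagram_class D"
    using generate.one[of diagram_module four_term] by (force simp: diagram_class_def r_coset_def)
  then obtain h where "h \<in> four_term_submodule" "frag_of D = h + frag_of D'"
    unfolding assms by (auto simp: diagram_class_def r_coset_def)
  then show ?thesis by simp
qed

theorem mainTheorem2:
  shows "\<exists>D\<^sub>1 D\<^sub>2 D D'. connected_sum D\<^sub>1 D\<^sub>2 D \<and> connected_sum D\<^sub>1 D\<^sub>2 D' \<and>
           diagram_class D \<noteq> diagram_class D'"
proof -
  define w1 w2 :: "chord list"
    where "w1 = [(2, 1), (2, 1)]" and "w2 = [(0, 0), (0, 0), (1, 1), (1, 1)]"
  \<comment> \<open>rotating \<^term>\<open>w2\<close> by one place moves the cut between the ends of the chord of framing 0\<close>
  have cw: "chord_word w1" "chord_word w2" "chord_word (rotate 1 w2)"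
    by (auto simp: w1_def w2_def chord_word_def)
  have cws: "chord_word (w1 @ w2)" "chord_word (w1 @ rotate 1 w2)"
    by (auto simp: w1_def w2_def chord_word_def)
  have disj: "set w1 \<inter> set w2 = {}" by (auto simp: w1_def w2_def)
  have "connected_sum (close w1) (close w2) (close (w1 @ w2))"
    "connected_sum (close w1) (close w2) (close (w1 @ rotate 1 w2))"
    unfolding connected_sum_def cut_of_def
    using cw disj close_rotate[OF cw(2), of 1] by (blast, metis set_rotate)
  moreover have "excess (frag_of (close (w1 @ w2))) = 0" "excess (frag_of (close (w1 @ rotate 1 w2))) = -1"
    using cws unfolding w1_def w2_def by (simp_all add: excess_six)
  then have "excess (frag_of (close (w1 @ w2)) - frag_of (close (w1 @ rotate 1 w2))) \<noteq> 0"
    unfolding excess_linear by simp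
  then have "diagram_class (close (w1 @ w2)) \<noteq> diagram_class (close (w1 @ rotate 1 w2))"
    using submodule_excess diagram_class_eqD by blast
  ultimately show ?thesis by blast
qed

end
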